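(* For every integer $b\ge 1$, $$\rho_{<}(Q_{2,b})=\frac12 .$$
   Context: An ordered graph is a finite graph with a fixed linear order on its vertices. An ordered copy of $F$ in $H$ is an injective graph embedding (edges map to edges, not necessarily induced) of $F$ into $H$ that preserves the vertex order. For ordered graphs $F,G$ let $\operatorname{ex}_{<}(G,F)=\max\{e(H): H\subseteq G,\ H \text{ contains no ordered copy of } F\}$. The relative Turán density of $F$ is $\rho_{<}(F)=\inf_G \operatorname{ex}_{<}(G,F)/e(G)$, where the infimum is over all ordered graphs $G$ with at least one edge. For $b\ge1$, $Q_{2,b}$ is the ordered graph on vertices $1<2<\cdots<b+3$ with edges $12,\ 13,\ 23,\ 34,\ 45,\ \ldots,\ (b+2)(b+3)$. *)

theory Defs
  imports Complex_Main
begin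

text \<open>
  Simple graphs whose vertices come from a linearly ordered type; the linear order on the
  vertex set is the one of the type.
\<close>

record 'a ograph =
  verts :: "'a set"
  edges :: "'a set set"

definition ordered_graph :: "'a::linorder ograph \<Rightarrow> bool" where
  "ordered_graph G \<longleftrightarrow>
     finite (verts G) \<and> (\<forall>e\<in>edges G. e \<subseteq> verts G \<and> card e = 2)"

definition subgraph :: "'a::linorder ograph \<Rightarrow> 'a ograph \<Rightarrow> bool" where
  "subgraph H G \<longleftrightarrow> ordered_graph H \<and> verts H \<subseteq> verts G \<and> edges H \<subseteq> edges G"

text \<open>Strict monotonicity also gives injectivity. Copies need not be induced.\<close>

definition ordered_copy :: "('b::linorder \<Rightarrow> 'a::linorder) \<Rightarrow> 'b ograph \<Rightarrow> 'a ograph \<Rightarrow> bool" where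
  "ordered_copy f F H \<longleftrightarrow>
     strict_mono_on (verts F) f \<and> f ` verts F \<subseteq> verts H \<and> (\<forall>e\<in>edges F. f ` e \<in> edges H)"

definition contains_ordered_copy :: "'a::linorder ograph \<Rightarrow> 'b::linorder ograph \<Rightarrow> bool" where
  "contains_ordered_copy H F \<longleftrightarrow> (\<exists>f. ordered_copy f F H)"

definition ex_ord :: "'a::linorder ograph \<Rightarrow> 'b::linorder ograph \<Rightarrow> nat" where
  "ex_ord G F = Max {card (edges H) | H. subgraph H G \<and> \<not> contains_ordered_copy H F}"

text \<open>
  Every finite linear order embeds into the natural numbers, so up to order isomorphism
  the graphs on natural numbers are all ordered graphs.
\<close>

definition rel_turan_density :: "'b::linorder ograph \<Rightarrow> real" where
  "rel_turan_density F =
     (INF G \<in> {G :: nat ograph. ordered_graph G \<and> edges G \<noteq> {}}.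
        real (ex_ord G F) / real (card (edges G)))"

definition Q2 :: "nat \<Rightarrow> nat ograph" where
  "Q2 b = \<lparr> verts = {1..b+3},
            edges = insert {1,3} {{i, i+1} | i. 1 \<le> i \<and> i \<le> b + 2} \<rparr>"

lemma ordered_graph_Q2: "ordered_graph (Q2 b)"
  by (auto simp: ordered_graph_def Q2_def)

lemma ordered_graph_finite_edges:
  assumes "ordered_graph G" shows "finite (edges G)"
  using assms by (intro finite_subset[of "edges G" "Pow (verts G)"]) (auto simp: ordered_graph_def)

text \<open>The maximum in \<^const>\<open>ex_ord\<close> is attained as soon as \<open>F\<close> has a vertex.\<close>

lemma ex_ord_attained:
  assumes "ordered_graph G" and "verts F \<noteq> {}"
  shows "\<exists>H. subgraph H G \<and> \<not> contains_ordered_copy H F \<and> ex_ord G F = card (edges H)"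
proof -
  let ?S = "{card (edges H) | H. subgraph H G \<and> \<not> contains_ordered_copy H F}"
  have "?S \<subseteq> {..card (edges G)}"
    using ordered_graph_finite_edges[OF assms(1)] by (auto simp: subgraph_def intro: card_mono)
  hence fin: "finite ?S" by (rule finite_subset) simp
  have "subgraph \<lparr>verts = {}, edges = {}\<rparr> G"
    by (simp add: subgraph_def ordered_graph_def)
  moreover have "\<not> contains_ordered_copy \<lparr>verts = {}, edges = {}\<rparr> F"
    using assms(2) by (simp add: contains_ordered_copy_def ordered_copy_def)
  ultimately have "?S \<noteq> {}" by blast
  from Max_in[OF fin this] show ?thesis by (auto simp: ex_ord_def)
qed

end

theory Submission
  imports Defs
begin

text \<open>
  \<^bold>\<open>Lower bound.\<close> Every graph has a cut with at least half of its edges. A cut contains no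
  triangle, so it contains no copy of \<open>Q2 b\<close>.

  \<^bold>\<open>Upper bound.\<close> Let \<open>H\<close> be free of \<open>Q2 b\<close>. Colour a vertex \<open>0\<close> if it is not the end of a triangle
  followed by an increasing path of \<open>H\<close> (the triangle's largest vertex counting as a path without
  edges), and otherwise by the number of vertices of the longest such path. There are at most
  \<open>b + 1\<close> colours, the colour increases along every edge that does not lie inside class \<open>0\<close>, and
  class \<open>0\<close> spans no triangle (lemma \<open>Q2_free_colouring\<close>).

  Suppose that a set of \<open>n\<close> vertices is cut into \<open>m\<close> consecutive parts on which the colours are
  distributed in the same way, and that all pairs from different parts are edges of the host
  graph, about \<open>n\<^sup>2 / 2\<close> in number. By Mantel's theorem \<open>H\<close> has at most \<open>z\<^sup>2 / 4\<close> edges inside class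
  \<open>0\<close>, where \<open>z\<close> is its size. For the remaining edges the colour goes up from left to right; since
  the parts look alike, going up is as frequent as going down, so that there are at most
  \<open>(n\<^sup>2 - z\<^sup>2) / 4\<close> of them. Hence \<open>H\<close> keeps about half of the edges (lemma \<open>tile_edge_bound\<close>, with an
  error measured by the deviation of the parts from their average).

  It remains to find a host graph most of whose edges lie in such sets, whatever the colouring.
  In an \<open>m\<close>-ary tree the colour densities along a branch form a bounded martingale, so at all
  but few levels most nodes have children that look alike. But in the complete graph on the leaves
  almost all pairs separate near the root, and a colouring may be bad exactly there; all levels
  must carry the same number of edges. This is achieved by adding a second coordinate. With \<open>W = m ^ M\<close> the
  vertices are the pairs \<open>(A, B)\<close> with \<open>A, B < W\<close> in lexicographic order. For \<open>h < M\<close> a tile of level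
  \<open>h\<close> is the product of an aligned interval of length \<open>m ^ (h + 1)\<close> for \<open>A\<close> with one of length
  \<open>m ^ (M - 1 - h)\<close> for \<open>B\<close>; it is cut into \<open>m\<close> children by its first coordinate, and its edges
  join different children. All tiles have \<open>W\<close> vertices, so all \<open>M\<close> levels have equally many edges.
  For a fixed \<open>B\<close> the squared deviations telescope over the levels (lemma \<open>telescoping_energy\<close>), and
  averaging over \<open>B\<close> can only decrease them (lemma \<open>cell_energy\<close>). Their total over all levels is
  therefore at most \<open>W\<^sup>3 / m\<close>, which for large \<open>M\<close> is negligible compared with the number of edges,
  about \<open>M * W\<^sup>3 / 2\<close>.
\<close>

section \<open>Squared deviations and Mantel's theorem\<close>

lemma sum_squared_deviation:
  fixes x :: "'a \<Rightarrow> real"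
  assumes "finite I" "I \<noteq> {}"
  shows "(\<Sum>i\<in>I. (x i - (\<Sum>i\<in>I. x i) / card I)\<^sup>2) = (\<Sum>i\<in>I. (x i)\<^sup>2) - (\<Sum>i\<in>I. x i)\<^sup>2 / card I"
proof -
  let ?s = "\<Sum>i\<in>I. x i"
  have pos: "real (card I) > 0" using assms by (simp add: card_gt_0_iff)
  have "(\<Sum>i\<in>I. (x i - ?s / card I)\<^sup>2)
      = (\<Sum>i\<in>I. (x i)\<^sup>2) - (\<Sum>i\<in>I. 2 * (?s / card I) * x i) + card I * (?s / card I)\<^sup>2"
    by (simp add: power2_diff sum.distrib sum_subtractf mult_ac)
  also have "\<dots> = (\<Sum>i\<in>I. (x i)\<^sup>2) - 2 * (?s / card I) * ?s + card I * (?s / card I)\<^sup>2"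
    by (simp only: sum_distrib_left)
  finally show ?thesis using pos by (simp add: field_simps power2_eq_square)
qed

lemma square_sum_le:
  fixes x :: "'a \<Rightarrow> real"
  assumes "finite I"
  shows "(\<Sum>i\<in>I. x i)\<^sup>2 \<le> card I * (\<Sum>i\<in>I. (x i)\<^sup>2)"
proof (cases "I = {}")
  case False
  then have "0 \<le> (\<Sum>i\<in>I. (x i)\<^sup>2) - (\<Sum>i\<in>I. x i)\<^sup>2 / card I"
    using assms by (subst sum_squared_deviation[symmetric]) (auto intro: sum_nonneg)
  moreover have "real (card I) > 0" using False assms by (simp add: card_gt_0_iff)
  ultimately show ?thesis by (simp add: field_simps)
qed simp

text \<open>
  The neighbourhoods of adjacent vertices are disjoint, so adjacent degrees add up to at most
  \<open>card Z\<close>. Summed over \<open>S\<close>, the left side is twice the sum of the squared degrees, which the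
  Cauchy--Schwarz inequality bounds below. Here \<open>S\<close> contains each edge in both directions, so
  that the conclusion bounds the number of edges by \<open>(card Z)\<^sup>2 / 4\<close>.
\<close>

lemma mantel:
  assumes "finite Z" and S: "S \<subseteq> Z \<times> Z" and "sym S"
    and free: "\<And>x y z. (x, y) \<in> S \<Longrightarrow> (y, z) \<in> S \<Longrightarrow> (x, z) \<notin> S"
  shows "2 * real (card S) \<le> (real (card Z))\<^sup>2"
proof -
  define N where "N x = S `` {x}" for x
  define d where "d x = real (card (N x))" for x
  have NZ: "N x \<subseteq> Z" for x using S by (auto simp: N_def)
  have finN: "finite (N x)" for x using NZ assms(1) by (rule finite_subset)
  have S_eq: "S = Sigma Z N" using S by (auto simp: N_def)
  have fst_sum: "(\<Sum>(x, y)\<in>S. f x) = (\<Sum>x\<in>Z. d x * f x)" for f :: "'a \<Rightarrow> real"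
    unfolding S_eq using assms(1) finN by (subst sum.Sigma[symmetric]) (auto simp: d_def)
  have snd_sum: "(\<Sum>(x, y)\<in>S. f y) = (\<Sum>(x, y)\<in>S. f x)" for f :: "'a \<Rightarrow> real"
    by (rule sum.reindex_bij_witness[of _ "\<lambda>(x, y). (y, x)" "\<lambda>(x, y). (y, x)"])
      (use \<open>sym S\<close> in \<open>auto dest: symD\<close>)
  have deg: "d x + d y \<le> card Z" if "(x, y) \<in> S" for x y
  proof -
    have "N x \<inter> N y = {}"
      using free that \<open>sym S\<close> by (auto simp: N_def)
    then have "card (N x) + card (N y) = card (N x \<union> N y)"
      using finN by (simp add: card_Un_disjoint)
    also have "\<dots> \<le> card Z" using NZ assms(1) by (intro card_mono) auto
    finally show ?thesis by (simp add: d_def)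
  qed
  have card_S: "real (card S) = (\<Sum>x\<in>Z. d x)"
    unfolding S_eq using assms(1) finN by (simp add: d_def)
  have "(\<Sum>(x, y)\<in>S. d x + d y) = 2 * (\<Sum>x\<in>Z. (d x)\<^sup>2)"
    using snd_sum[of d] fst_sum[of d]
    by (simp add: case_prod_unfold sum.distrib power2_eq_square)
  moreover have "(\<Sum>(x, y)\<in>S. d x + d y) \<le> (\<Sum>(x, y)\<in>S. real (card Z))"
    using deg by (intro sum_mono) auto
  ultimately have upper: "2 * (\<Sum>x\<in>Z. (d x)\<^sup>2) \<le> real (card S) * card Z"
    by (simp add: case_prod_unfold)
  have "(real (card S))\<^sup>2 \<le> card Z * (\<Sum>x\<in>Z. (d x)\<^sup>2)"
    using square_sum_le[OF assms(1)] by (simp add: card_S)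
  then have "2 * (real (card S))\<^sup>2 \<le> card Z * (2 * (\<Sum>x\<in>Z. (d x)\<^sup>2))"
    by simp
  also have "\<dots> \<le> card Z * (real (card S) * card Z)"
    using upper by (intro mult_left_mono) auto
  finally have "real (card S) * (2 * card S) \<le> real (card S) * (real (card Z))\<^sup>2"
    by (simp add: power2_eq_square mult_ac)
  then show ?thesis
    by (cases "card S = 0") (auto dest: mult_left_le_imp_le)
qed

section \<open>Large cuts and the lower bound\<close>

lemma double_card_filter:
  assumes "finite X"
  shows "2 * card {x \<in> X. P x} = (\<Sum>x\<in>X. if P x then 2 else 0)"
proof -
  have "(\<Sum>x\<in>X. if P x then 2 else 0) = (\<Sum>x\<in>{x \<in> X. P x}. 2::nat)"
    by (rule sum.inter_filter[OF assms, symmetric])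
  also have "\<dots> = 2 * card {x \<in> X. P x}"
    by (simp only: sum_constant of_nat_id mult.commute)
  finally show ?thesis ..
qed

text \<open>
  Moving one end of an edge to the other side is an involution on the subsets \<open>A\<close> that matches
  those cutting the edge with those not cutting it. So an average cut contains half of the edges.
\<close>

lemma max_cut:
  assumes "ordered_graph G"
  shows "\<exists>A. card (edges G) \<le> 2 * card {e \<in> edges G. card (e \<inter> A) = 1}"
proof -
  let ?V = "verts G" and ?E = "edges G"
  have finV: "finite ?V" and finE: "finite ?E"
    using assms ordered_graph_finite_edges by (auto simp: ordered_graph_def)
  have half: "2 * card {A \<in> Pow ?V. card (e \<inter> A) = 1} = card (Pow ?V)" if "e \<in> ?E" for e
  proof -
    have "card e = 2" "e \<subseteq> ?V" using that assms by (auto simp: ordered_graph_def)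
    then obtain x y where e: "e = {x, y}" "x \<noteq> y" "x \<in> ?V" "y \<in> ?V"
      by (metis card_2_iff insert_subset)
    let ?C = "{A \<in> Pow ?V. card (e \<inter> A) = 1}" and ?D = "{A \<in> Pow ?V. card (e \<inter> A) \<noteq> 1}"
    define t where "t A = (if x \<in> A then A - {x} else insert x A)" for A
    have cut: "card (e \<inter> A) = 1 \<longleftrightarrow> (x \<in> A) \<noteq> (y \<in> A)" for A
      using e by (cases "x \<in> A"; cases "y \<in> A") simp_all
    have t: "x \<in> t A \<longleftrightarrow> x \<notin> A" "y \<in> t A \<longleftrightarrow> y \<in> A" "t (t A) = A" for A
      using e(2) by (auto simp: t_def)
    have t_sub: "t A \<subseteq> ?V \<longleftrightarrow> A \<subseteq> ?V" for A
      using e(3) by (auto simp: t_def)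
    have "bij_betw t ?C ?D"
      unfolding cut Pow_iff by (rule bij_betw_byWitness[where f' = t]) (auto simp: t dest: t_sub[THEN iffD2, THEN subsetD])
    then have "card ?C = card ?D" by (rule bij_betw_same_card)
    moreover have "card ?C + card ?D = card (?C \<union> ?D)"
      by (rule card_Un_disjoint[symmetric]) (use finV in auto)
    moreover have "?C \<union> ?D = Pow ?V" by blast
    ultimately show ?thesis by simp
  qed
  have "(\<Sum>A\<in>Pow ?V. 2 * card {e \<in> ?E. card (e \<inter> A) = 1})
      = (\<Sum>A\<in>Pow ?V. \<Sum>e\<in>?E. if card (e \<inter> A) = 1 then 2 else 0)"
    by (intro sum.cong refl double_card_filter finE)
  also have "\<dots> = (\<Sum>e\<in>?E. \<Sum>A\<in>Pow ?V. if card (e \<inter> A) = 1 then 2 else 0)"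
    by (rule sum.swap)
  also have "\<dots> = (\<Sum>e\<in>?E. card (Pow ?V))"
    using half finV by (intro sum.cong refl) (simp only: double_card_filter[symmetric] finite_Pow_iff)
  also have "\<dots> = (\<Sum>A\<in>Pow ?V. card ?E)"
    by simp
  finally have total: "(\<Sum>A\<in>Pow ?V. 2 * card {e \<in> ?E. card (e \<inter> A) = 1}) = (\<Sum>A\<in>Pow ?V. card ?E)" .
  have "\<not> (\<forall>A\<in>Pow ?V. 2 * card {e \<in> ?E. card (e \<inter> A) = 1} < card ?E)"
  proof
    assume "\<forall>A\<in>Pow ?V. 2 * card {e \<in> ?E. card (e \<inter> A) = 1} < card ?E"
    then have "(\<Sum>A\<in>Pow ?V. 2 * card {e \<in> ?E. card (e \<inter> A) = 1}) < (\<Sum>A\<in>Pow ?V. card ?E)"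
      using finV by (intro sum_strict_mono) auto
    then show False using total by simp
  qed
  then show ?thesis by (meson not_less)
qed

lemma ex_ord_Q2_ge_half:
  assumes "ordered_graph G"
  shows "card (edges G) \<le> 2 * ex_ord G (Q2 b)"
proof -
  obtain A where A: "card (edges G) \<le> 2 * card {e \<in> edges G. card (e \<inter> A) = 1}"
    using max_cut[OF assms] by blast
  define H where "H = \<lparr>verts = verts G, edges = {e \<in> edges G. card (e \<inter> A) = 1}\<rparr>"
  have sub: "subgraph H G" using assms by (auto simp: subgraph_def ordered_graph_def H_def)
  have "\<not> contains_ordered_copy H (Q2 b)"
  proof
    assume "contains_ordered_copy H (Q2 b)"
    then obtain f where f: "strict_mono_on {1..b+3} f"
        "\<forall>e\<in>edges (Q2 b). card (f ` e \<inter> A) = 1"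
      by (auto simp: contains_ordered_copy_def ordered_copy_def Q2_def H_def)
    have lt: "f 1 < f 2" "f 2 < f 3"
      using f(1) by (auto simp: strict_mono_on_def)
    have "{1,3} \<in> edges (Q2 b)" by (auto simp: Q2_def)
    moreover have "{1,2} \<in> edges (Q2 b)" by (auto simp: Q2_def intro!: exI[of _ 1])
    moreover have "{2,3} \<in> edges (Q2 b)" by (auto simp: Q2_def intro!: exI[of _ 2])
    ultimately have "card ({f 1, f 3} \<inter> A) = 1" "card ({f 1, f 2} \<inter> A) = 1"
        "card ({f 2, f 3} \<inter> A) = 1"
      using f(2) by fastforce+
    then show False using lt
      by (cases "f 1 \<in> A"; cases "f 2 \<in> A"; cases "f 3 \<in> A") auto
  qed
  with sub have "card (edges H) \<in> {card (edges H) | H. subgraph H G \<and> \<not> contains_ordered_copy H (Q2 b)}"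
    by blast
  moreover have "finite {card (edges H) | H. subgraph H G \<and> \<not> contains_ordered_copy H (Q2 b)}"
    by (rule finite_subset[of _ "{..card (edges G)}"])
      (use ordered_graph_finite_edges[OF assms] in \<open>auto simp: subgraph_def intro: card_mono\<close>)
  ultimately have "card (edges H) \<le> ex_ord G (Q2 b)"
    unfolding ex_ord_def by (rule Max_ge[rotated])
  with A show ?thesis by (simp add: H_def)
qed

lemma rel_turan_density_Q2_ge: "1 / 2 \<le> rel_turan_density (Q2 b)"
  unfolding rel_turan_density_def
proof (rule cINF_greatest)
  have "ordered_graph \<lparr>verts = {0, 1}, edges = {{0, 1::nat}}\<rparr>" by (auto simp: ordered_graph_def)
  then show "{G :: nat ograph. ordered_graph G \<and> edges G \<noteq> {}} \<noteq> {}" by force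
next
  fix G :: "nat ograph" assume G: "G \<in> {G. ordered_graph G \<and> edges G \<noteq> {}}"
  then have "card (edges G) > 0" using ordered_graph_finite_edges by (auto simp: card_gt_0_iff)
  moreover have "real (card (edges G)) \<le> 2 * real (ex_ord G (Q2 b))"
    using ex_ord_Q2_ge_half[of G b] G by simp
  ultimately show "1 / 2 \<le> real (ex_ord G (Q2 b)) / real (card (edges G))"
    by (simp add: field_simps)
qed

section \<open>A colouring of the graphs without a copy\<close>

text \<open>
  The vertex \<open>z\<close> is the last vertex of a triangle followed by an increasing path of \<open>j\<close> edges, that
  is, of a copy of \<open>Q2 j\<close>. The case \<open>j = 0\<close> is that of a bare triangle with largest vertex \<open>z\<close>.
\<close>

inductive tail_end :: "'a::linorder ograph \<Rightarrow> nat \<Rightarrow> 'a \<Rightarrow> bool" for H where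
  top: "\<lbrakk>x < y; y < z; {x, y} \<in> edges H; {y, z} \<in> edges H; {x, z} \<in> edges H\<rbrakk> \<Longrightarrow> tail_end H 0 z"
| step: "\<lbrakk>tail_end H j x; x < y; {x, y} \<in> edges H\<rbrakk> \<Longrightarrow> tail_end H (Suc j) y"

lemma tail_end_copy:
  assumes "tail_end H j z" and "ordered_graph H"
  shows "\<exists>f. ordered_copy f (Q2 j) H \<and> f (j + 3) = z"
  using assms(1)
proof induction
  case (top x y z)
  define f where "f = (\<lambda>i::nat. if i = 1 then x else if i = 2 then y else z)"
  have V: "x \<in> verts H" "y \<in> verts H" "z \<in> verts H"
    using top assms(2) unfolding ordered_graph_def by blast+
  have "f ` e \<in> edges H" if "e \<in> edges (Q2 0)" for e
  proof -
    have "e = {1,3} \<or> (\<exists>i. (i = 1 \<or> i = 2) \<and> e = {i, i+1})"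
      using that by (fastforce simp: Q2_def)
    then have "e = {1,3} \<or> e = {1,2} \<or> e = {2,3}" by auto
    then show ?thesis using top by (auto simp: f_def insert_commute)
  qed
  moreover have "strict_mono_on {1..3} f"
    using top by (auto simp: strict_mono_on_def f_def)
  ultimately have "ordered_copy f (Q2 0) H"
    using V by (auto simp: ordered_copy_def Q2_def f_def)
  then show ?case by (intro exI[of _ f]) (simp add: f_def)
next
  case (step j x y)
  then obtain f where f: "ordered_copy f (Q2 j) H" "f (j + 3) = x" by blast
  define g where "g = f(j + 4 := y)"
  have y: "y \<in> verts H" using step(3) assms(2) unfolding ordered_graph_def by blast
  have fm: "f i < f i'" if "1 \<le> i" "i < i'" "i' \<le> j + 3" for i i'
    using f(1) that by (auto simp: ordered_copy_def Q2_def strict_mono_on_def)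
  have "strict_mono_on {1..j+4} g"
  proof (rule strict_mono_onI)
    fix i i' assume i: "i \<in> {1..j+4}" "i' \<in> {1..j+4}" "i < i'"
    show "g i < g i'"
    proof (cases "i' = j + 4")
      case True
      then have "f i \<le> x" using fm[of i "j + 3"] f(2) i by (cases "i = j + 3") auto
      then show ?thesis using True i step by (auto simp: g_def)
    qed (use i fm in \<open>auto simp: g_def\<close>)
  qed
  moreover have "g ` {1..j+4} \<subseteq> verts H"
    using y f(1) by (auto simp: g_def ordered_copy_def Q2_def image_subset_iff)
  moreover have "g ` e \<in> edges H" if "e \<in> edges (Q2 (Suc j))" for e
  proof (cases "j + 4 \<in> e")
    case True
    then have "e = {j + 3, j + 4}" using that by (auto simp: Q2_def)
    then show ?thesis using step f(2) by (simp add: g_def)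
  next
    case False
    consider "e = {1, 3}" | i where "e = {i, i + 1}" "1 \<le> i" "i \<le> j + 3"
      using \<open>e \<in> edges (Q2 (Suc j))\<close> by (auto simp: Q2_def)
    then have "e \<in> edges (Q2 j)"
    proof cases
      case (2 i)
      with False have "i \<noteq> j + 3" by auto
      with 2 show ?thesis by (auto simp: Q2_def intro!: exI[of _ i])
    qed (auto simp: Q2_def)
    moreover have "g ` e = f ` e" using False by (auto simp: g_def image_iff)
    ultimately show ?thesis using f(1) by (simp add: ordered_copy_def)
  qed
  moreover have "verts (Q2 (Suc j)) = {1..j+4}" by (simp add: Q2_def)
  ultimately have "ordered_copy g (Q2 (Suc j)) H"
    unfolding ordered_copy_def by simp
  moreover have "g (Suc j + 3) = y" by (simp add: g_def)
  ultimately show ?case by blast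
qed

text \<open>
  The colour is one plus the length of the longest path that ends at the vertex and hangs from a
  triangle, and \<open>0\<close> if there is none. An edge that leaves a vertex of positive colour prolongs
  its path; the largest vertex of a triangle has positive colour by definition.
\<close>

lemma Q2_free_colouring:
  fixes H :: "'a::linorder ograph"
  assumes H: "ordered_graph H" and free: "\<not> contains_ordered_copy H (Q2 b)"
  obtains c :: "'a \<Rightarrow> nat" where "\<And>x. c x \<le> b"
    and "\<And>x y. x < y \<Longrightarrow> {x, y} \<in> edges H \<Longrightarrow> c x < c y \<or> c x = 0 \<and> c y = 0"
    and "\<And>x y z. \<lbrakk>{x, y} \<in> edges H; {y, z} \<in> edges H; {x, z} \<in> edges H\<rbrakk>
      \<Longrightarrow> c x \<noteq> 0 \<or> c y \<noteq> 0 \<or> c z \<noteq> 0"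
proof -
  have small: "j < b" if "tail_end H j x" for j x
  proof (rule ccontr)
    assume "\<not> j < b"
    then have sub: "verts (Q2 b) \<subseteq> verts (Q2 j)" "edges (Q2 b) \<subseteq> edges (Q2 j)"
      by (auto simp: Q2_def)
    obtain f where "ordered_copy f (Q2 j) H"
      using tail_end_copy[OF \<open>tail_end H j x\<close> H] by blast
    then have "ordered_copy f (Q2 b) H"
      using sub by (auto simp: ordered_copy_def intro: monotone_on_subset)
    then show False using free by (auto simp: contains_ordered_copy_def)
  qed
  define J where "J x = insert 0 {Suc j | j. tail_end H j x}" for x
  define c where "c x = Max (J x)" for x
  have J_le: "J x \<subseteq> {..b}" for x using small by (auto simp: J_def Suc_le_eq)
  then have fin: "finite (J x)" for x by (rule finite_subset) simp
  have cJ: "c x \<in> J x" for x unfolding c_def using fin by (rule Max_in) (simp add: J_def)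
  have c_ge: "Suc j \<le> c x" if "tail_end H j x" for j x
    unfolding c_def using fin that by (intro Max_ge) (auto simp: J_def)
  have le: "c x \<le> b" for x using cJ J_le by blast
  have up: "c x < c y \<or> c x = 0 \<and> c y = 0" if "x < y" "{x, y} \<in> edges H" for x y
  proof (cases "c x = 0")
    case False
    then obtain j where j: "c x = Suc j" "tail_end H j x" using cJ[of x] by (auto simp: J_def)
    then have "tail_end H (Suc j) y" using that by (auto intro: tail_end.step)
    then show ?thesis using c_ge j by force
  qed auto
  have tri: "c z \<noteq> 0" if "x < y" "y < z" "{x, y} \<in> edges H" "{y, z} \<in> edges H" "{x, z} \<in> edges H" for x y z
    using c_ge[OF tail_end.top[OF that]] by simp
  have "c x \<noteq> 0 \<or> c y \<noteq> 0 \<or> c z \<noteq> 0"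
    if e: "{x, y} \<in> edges H" "{y, z} \<in> edges H" "{x, z} \<in> edges H" for x y z
  proof -
    have "x \<noteq> y" "y \<noteq> z" "x \<noteq> z"
      using e H unfolding ordered_graph_def by fastforce+
    moreover have "{y, x} \<in> edges H" "{z, y} \<in> edges H" "{z, x} \<in> edges H"
      using e by (simp_all add: insert_commute)
    ultimately show ?thesis using e tri by (metis linorder_neqE)
  qed
  with le up show ?thesis by (rule that)
qed

section \<open>Edges between parts with similar colour distributions\<close>

lemma sum_pairs_less:
  "(\<Sum>t<k. \<Sum>s<t. p s * p t) = ((\<Sum>s<k. p s)\<^sup>2 - (\<Sum>s<k. (p s)\<^sup>2)) / 2" for p :: "nat \<Rightarrow> real"
proof (induction k)
  case (Suc k)
  have "(\<Sum>t<Suc k. \<Sum>s<t. p s * p t) = (\<Sum>t<k. \<Sum>s<t. p s * p t) + (\<Sum>s<k. p s) * p k"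
    by (simp add: sum_distrib_right)
  also have "\<dots> = ((\<Sum>s<Suc k. p s)\<^sup>2 - (\<Sum>s<Suc k. (p s)\<^sup>2)) / 2"
    unfolding Suc.IH by (simp add: power2_eq_square field_simps)
  finally show ?case .
qed simp

lemma sum_triangle: "(\<Sum>j<m. \<Sum>i<j. C) = C * (real m * (real m - 1) / 2)" for C :: real
  by (induction m) (auto simp: field_simps)

lemma sum_pairs_le_square:
  fixes e :: "nat \<Rightarrow> nat \<Rightarrow> real"
  assumes "\<And>i j. 0 \<le> e i j"
  shows "(\<Sum>j<m. \<Sum>i<j. e i j) \<le> (\<Sum>j<m. \<Sum>i<m. e i j)"
  using assms by (intro sum_mono sum_mono2) auto

text \<open>
  Here \<open>n i s\<close> stands for the number of vertices of colour \<open>s\<close> in part \<open>i\<close>, so that the double sum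
  counts the pairs whose part and colour both go up. If each part had the average number
  \<open>p s / m\<close> of vertices of colour \<open>s\<close>, that count would be at most \<open>1/2\<close> of the number
  \<open>(T\<^sup>2 - (\<Sum>s<k. (p s)\<^sup>2)) / 2\<close> of unordered pairs with different colours, of which the square of
  \<open>p 0\<close> is compensated by the first term. Replacing the two factors of \<open>n i s * n j t\<close> by their
  averages one after the other costs at most \<open>T\<close> times the total deviation each.
\<close>

lemma up_pairs_bound:
  fixes n :: "nat \<Rightarrow> nat \<Rightarrow> real"
  assumes "m > 0" "k > 0" and pos: "\<And>i s. 0 \<le> n i s"
  defines "p \<equiv> \<lambda>s. \<Sum>i<m. n i s"
  defines "T \<equiv> \<Sum>s<k. p s"
  shows "(p 0)\<^sup>2 / 4 + (\<Sum>j<m. \<Sum>i<j. \<Sum>t<k. \<Sum>s<t. n i s * n j t)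
    \<le> T\<^sup>2 / 4 + 2 * T * (\<Sum>i<m. \<Sum>s<k. \<bar>n i s - p s / m\<bar>)"
proof -
  define d where "d i s = \<bar>n i s - p s / m\<bar>" for i s
  define D where "D = (\<Sum>i<m. \<Sum>s<k. d i s)"
  have p_pos: "0 \<le> p s" for s unfolding p_def by (intro sum_nonneg pos)
  have T_alt: "T = (\<Sum>i<m. \<Sum>s<k. n i s)" unfolding T_def p_def by (rule sum.swap)
  \<comment> \<open>For signed deviations this is an identity, and the factors next to them are nonnegative.\<close>
  have prod_le: "n i s * n j t \<le> p s / m * (p t / m) + (d i s * n j t + p s / m * d j t)" for i j s t
  proof -
    have "n i s * n j t = p s / m * (p t / m)
        + ((n i s - p s / m) * n j t + p s / m * (n j t - p t / m))"
      by (simp add: algebra_simps)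
    also have "\<dots> \<le> p s / m * (p t / m) + (d i s * n j t + p s / m * d j t)"
      unfolding d_def using pos p_pos by (intro add_mono mult_right_mono mult_left_mono) auto
    finally show ?thesis .
  qed
  \<comment> \<open>The main term is evaluated on the pairs \<open>i < j\<close> and \<open>s < t\<close>; in the error term, which is
    nonnegative, both restrictions are dropped so that the sums factorize.\<close>
  have "(\<Sum>j<m. \<Sum>i<j. \<Sum>t<k. \<Sum>s<t. n i s * n j t)
      \<le> (\<Sum>j<m. \<Sum>i<j. \<Sum>t<k. \<Sum>s<t. p s / m * (p t / m) + (d i s * n j t + p s / m * d j t))"
    by (intro sum_mono prod_le)
  also have "\<dots> = (\<Sum>j<m. \<Sum>i<j. \<Sum>t<k. \<Sum>s<t. p s / m * (p t / m))
      + (\<Sum>j<m. \<Sum>i<j. \<Sum>t<k. \<Sum>s<t. d i s * n j t + p s / m * d j t)"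
    by (simp only: sum.distrib)
  also have "(\<Sum>j<m. \<Sum>i<j. \<Sum>t<k. \<Sum>s<t. p s / m * (p t / m)) \<le> (T\<^sup>2 - (p 0)\<^sup>2) / 4"
  proof -
    have "(\<Sum>t<k. \<Sum>s<t. p s / m * (p t / m)) = (\<Sum>t<k. \<Sum>s<t. p s * p t) / (real m)\<^sup>2"
      by (simp add: sum_divide_distrib power2_eq_square)
    then have "(\<Sum>j<m. \<Sum>i<j. \<Sum>t<k. \<Sum>s<t. p s / m * (p t / m))
        = (\<Sum>t<k. \<Sum>s<t. p s * p t) / (real m)\<^sup>2 * (real m * (real m - 1) / 2)"
      by (simp only: sum_triangle)
    also have "\<dots> \<le> (\<Sum>t<k. \<Sum>s<t. p s * p t) / (real m)\<^sup>2 * ((real m)\<^sup>2 / 2)"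
      using p_pos by (intro mult_left_mono divide_nonneg_nonneg sum_nonneg mult_nonneg_nonneg)
        (auto simp: power2_eq_square algebra_simps)
    also have "\<dots> = (\<Sum>t<k. \<Sum>s<t. p s * p t) / 2"
      using \<open>m > 0\<close> by simp
    also have "\<dots> = (T\<^sup>2 - (\<Sum>s<k. (p s)\<^sup>2)) / 4"
      by (simp add: sum_pairs_less T_def)
    also have "\<dots> \<le> (T\<^sup>2 - (p 0)\<^sup>2) / 4"
      using member_le_sum[of 0 "{..<k}" "\<lambda>s. (p s)\<^sup>2"] \<open>k > 0\<close> by simp
    finally show ?thesis .
  qed
  also have "(\<Sum>j<m. \<Sum>i<j. \<Sum>t<k. \<Sum>s<t. d i s * n j t + p s / m * d j t)
      \<le> (\<Sum>j<m. \<Sum>i<m. \<Sum>t<k. \<Sum>s<k. d i s * n j t + p s / m * d j t)"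
  proof -
    have nn: "0 \<le> d i s * n j t + p s / m * d j t" for i j s t
      unfolding d_def using pos p_pos by (intro add_nonneg_nonneg mult_nonneg_nonneg) auto
    have "(\<Sum>j<m. \<Sum>i<j. \<Sum>t<k. \<Sum>s<t. d i s * n j t + p s / m * d j t)
      \<le> (\<Sum>j<m. \<Sum>i<j. \<Sum>t<k. \<Sum>s<k. d i s * n j t + p s / m * d j t)"
      by (intro sum_mono sum_pairs_le_square nn)
    also have "\<dots> \<le> (\<Sum>j<m. \<Sum>i<m. \<Sum>t<k. \<Sum>s<k. d i s * n j t + p s / m * d j t)"
      by (intro sum_pairs_le_square sum_nonneg nn)
    finally show ?thesis .
  qed
  also have "\<dots> = 2 * T * D"
  proof -
    have inner: "(\<Sum>t<k. \<Sum>s<k. d i s * n j t + p s / m * d j t)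
        = (\<Sum>s<k. d i s) * (\<Sum>t<k. n j t) + T / m * (\<Sum>t<k. d j t)" for i j
    proof -
      have "(\<Sum>t<k. \<Sum>s<k. d i s * n j t) = (\<Sum>s<k. d i s) * (\<Sum>t<k. n j t)"
        by (subst sum.swap) (simp add: sum_product)
      moreover have "(\<Sum>t<k. \<Sum>s<k. p s / m * d j t) = T / m * (\<Sum>t<k. d j t)"
        unfolding T_def sum_divide_distrib by (subst sum.swap) (simp add: sum_product)
      ultimately show ?thesis by (simp add: sum.distrib)
    qed
    have "(\<Sum>j<m. \<Sum>i<m. (\<Sum>s<k. d i s) * (\<Sum>t<k. n j t)) = D * T"
      unfolding T_alt D_def by (subst sum.swap) (simp only: sum_product)
    moreover have "(\<Sum>j<m. \<Sum>i<m. T / m * (\<Sum>t<k. d j t)) = T * D"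
      unfolding D_def using \<open>m > 0\<close> by (simp add: sum_distrib_left)
    ultimately show ?thesis unfolding inner by (simp only: sum.distrib) simp
  qed
  finally show ?thesis by (simp add: d_def D_def field_simps)
qed

text \<open>
  A pair of \<open>P\<close> either has both ends in colour \<open>0\<close>, where Mantel's theorem applies, or its colour goes
  up together with the index of the part.
\<close>

lemma tile_edge_bound:
  fixes c :: "'v \<Rightarrow> nat" and X :: "nat \<Rightarrow> 'v set"
  assumes "m > 0" "k > 0" and fin: "\<And>i. finite (X i)"
    and disj: "\<And>i j. i \<noteq> j \<Longrightarrow> X i \<inter> X j = {}"
    and cols: "\<And>x. c x < k"
    and P: "P \<subseteq> (\<Union>j<m. \<Union>i<j. X i \<times> X j)"
    and up: "\<And>x y. (x, y) \<in> P \<Longrightarrow> c x < c y \<or> c x = 0 \<and> c y = 0"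
    and tri: "\<And>x y z. \<lbrakk>(x, y) \<in> P \<union> P\<inverse>; (y, z) \<in> P \<union> P\<inverse>; (x, z) \<in> P \<union> P\<inverse>\<rbrakk>
      \<Longrightarrow> c x \<noteq> 0 \<or> c y \<noteq> 0 \<or> c z \<noteq> 0"
  defines "n \<equiv> \<lambda>i s. real (card {x \<in> X i. c x = s})"
  defines "T \<equiv> real (card (\<Union>i<m. X i))"
  shows "real (card P) \<le> T\<^sup>2 / 4 + 2 * T * (\<Sum>i<m. \<Sum>s<k. \<bar>n i s - (\<Sum>j<m. n j s) / m\<bar>)"
proof -
  define Z where "Z = {x \<in> (\<Union>i<m. X i). c x = 0}"
  define P0 where "P0 = P \<inter> Z \<times> Z"
  define U where "U = (\<Union>j<m. \<Union>i<j. \<Union>t<k. \<Union>s<t. {x \<in> X i. c x = s} \<times> {y \<in> X j. c y = t})"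
  have finZ: "finite Z" unfolding Z_def using fin by auto
  have finP0: "finite P0" unfolding P0_def using finZ by auto
  have finU: "finite U" unfolding U_def using fin by auto
  have "P \<subseteq> P0 \<union> U"
  proof
    fix e assume "e \<in> P"
    then obtain x y i j where e: "e = (x, y)" "(x, y) \<in> P" "j < m" "i < j" "x \<in> X i" "y \<in> X j"
      using P by blast
    from up[OF e(2)] show "e \<in> P0 \<union> U"
    proof
      assume "c x < c y"
      then have "e \<in> U" using e cols by (auto simp: U_def)
      then show ?thesis ..
    next
      assume "c x = 0 \<and> c y = 0"
      moreover have "x \<in> (\<Union>i<m. X i)" "y \<in> (\<Union>i<m. X i)" using e by auto
      ultimately show ?thesis using e by (auto simp: P0_def Z_def)
    qed
  qed
  then have "card P \<le> card (P0 \<union> U)" using finP0 finU by (intro card_mono) auto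
  also have "\<dots> \<le> card P0 + card U" by (rule card_Un_le)
  finally have split: "real (card P) \<le> card P0 + card U" by simp
  have asym: "P0 \<inter> P0\<inverse> = {}"
  proof -
    have index: "i = i'" if "x \<in> X i" "x \<in> X i'" for x i i' using disj that by blast
    have "(y, x) \<notin> P" if xy: "(x, y) \<in> P" for x y
    proof
      assume "(y, x) \<in> P"
      then obtain i' j' where "i' < j'" "y \<in> X i'" "x \<in> X j'" using P by blast
      moreover obtain i j where "i < j" "x \<in> X i" "y \<in> X j" using P xy by blast
      ultimately show False using index by (metis less_asym)
    qed
    then show ?thesis by (auto simp: P0_def)
  qed
  have "2 * real (card (P0 \<union> P0\<inverse>)) \<le> (real (card Z))\<^sup>2"
  proof (rule mantel[OF finZ])
    show "P0 \<union> P0\<inverse> \<subseteq> Z \<times> Z" by (auto simp: P0_def)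
    show "sym (P0 \<union> P0\<inverse>)" by (auto simp: sym_def)
    fix x y z assume xy: "(x, y) \<in> P0 \<union> P0\<inverse>" and yz: "(y, z) \<in> P0 \<union> P0\<inverse>"
    show "(x, z) \<notin> P0 \<union> P0\<inverse>"
    proof
      assume "(x, z) \<in> P0 \<union> P0\<inverse>"
      with xy yz have "c x \<noteq> 0 \<or> c y \<noteq> 0 \<or> c z \<noteq> 0"
        by (intro tri) (auto simp: P0_def)
      with xy yz show False by (auto simp: P0_def Z_def)
    qed
  qed
  moreover have "card (P0 \<union> P0\<inverse>) = 2 * card P0"
    using asym finP0 by (simp add: card_Un_disjoint)
  ultimately have P0_le: "real (card P0) \<le> (real (card Z))\<^sup>2 / 4" by simp
  have "card Z = (\<Sum>i<m. card {x \<in> X i. c x = 0})"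
  proof -
    have "Z = (\<Union>i<m. {x \<in> X i. c x = 0})" by (auto simp: Z_def)
    then show ?thesis using fin disj by (subst card_UN_disjoint[symmetric]) auto
  qed
  then have Z_eq: "real (card Z) = (\<Sum>i<m. n i 0)" by (simp add: n_def)
  have T_eq: "T = (\<Sum>s<k. \<Sum>i<m. n i s)"
  proof -
    have "card (X i) = (\<Sum>s<k. card {x \<in> X i. c x = s})" for i
      using fin cols by (subst card_UN_disjoint[symmetric]) (auto intro: arg_cong[where f = card])
    then have "T = (\<Sum>i<m. \<Sum>s<k. n i s)"
      unfolding T_def n_def using fin disj by (subst card_UN_disjoint) auto
    then show ?thesis by (subst sum.swap)
  qed
  have "card U \<le> (\<Sum>j<m. \<Sum>i<j. \<Sum>t<k. \<Sum>s<t. card ({x \<in> X i. c x = s} \<times> {y \<in> X j. c y = t}))"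
    unfolding U_def by (intro order.trans[OF card_UN_le] sum_mono finite_lessThan order.refl)
  then have "real (card U)
      \<le> real (\<Sum>j<m. \<Sum>i<j. \<Sum>t<k. \<Sum>s<t. card ({x \<in> X i. c x = s} \<times> {y \<in> X j. c y = t}))"
    by (rule of_nat_mono)
  also have "\<dots> = (\<Sum>j<m. \<Sum>i<j. \<Sum>t<k. \<Sum>s<t. n i s * n j t)"
    by (simp add: n_def card_cartesian_product)
  finally have "real (card P) \<le> (\<Sum>i<m. n i 0)\<^sup>2 / 4 + (\<Sum>j<m. \<Sum>i<j. \<Sum>t<k. \<Sum>s<t. n i s * n j t)"
    using split P0_le by (simp add: Z_eq)
  also have "\<dots> \<le> T\<^sup>2 / 4 + 2 * T * (\<Sum>i<m. \<Sum>s<k. \<bar>n i s - (\<Sum>j<m. n j s) / m\<bar>)"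
    unfolding T_eq using up_pairs_bound[OF assms(1,2), of n] by (simp add: n_def)
  finally show ?thesis .
qed

section \<open>The energy of a colouring of the square grid\<close>

text \<open>
  The intervals of length \<open>L\<close> aligned at multiples of \<open>L\<close>. For \<open>L = m ^ h\<close> they are the sets of leaves
  below the nodes at height \<open>h\<close> of the \<open>m\<close>-ary tree.
\<close>

definition blk :: "nat \<Rightarrow> nat \<Rightarrow> nat set" where
  "blk L p = {p * L..<p * L + L}"

lemma mem_blk:
  assumes "L > 0"
  shows "x \<in> blk L p \<longleftrightarrow> x div L = p"
proof
  assume "x \<in> blk L p"
  then show "x div L = p" by (intro div_nat_eqI) (auto simp: blk_def algebra_simps)
next
  assume "x div L = p"
  then show "x \<in> blk L p"
    using assms by (auto simp: blk_def dividend_less_div_times add.commute)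
qed

lemma finite_blk [simp]: "finite (blk L p)" and card_blk [simp]: "card (blk L p) = L"
  by (simp_all add: blk_def)

lemma sum_consecutive_blocks:
  "(\<Sum>j<n. sum f {c + j * L..<c + j * L + L}) = sum f {c..<c + n * L}"
  for f :: "nat \<Rightarrow> 'a::comm_monoid_add"
proof (induction n)
  case (Suc n)
  have "sum f {c..<c + n * L} + sum f {c + n * L..<c + n * L + L} = sum f {c..<c + n * L + L}"
    by (rule sum.atLeastLessThan_concat) auto
  then show ?case using Suc by (simp add: add_ac)
qed simp

lemma sum_blk_refine: "(\<Sum>j<n. sum f (blk L (q * n + j))) = sum f (blk (n * L) q)"
  using sum_consecutive_blocks[of f "q * n * L" L n] by (simp add: blk_def algebra_simps)

lemma sum_blk_all: "(\<Sum>p<n. sum f (blk L p)) = sum f {..<n * L}"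
  using sum_blk_refine[of f L 0 n] by (simp add: blk_def lessThan_atLeast0)

lemma sum_lessThan_prod: "(\<Sum>u<n. \<Sum>a<m. f (u * m + a)) = (\<Sum>p<n * m. f p)"
  for f :: "nat \<Rightarrow> 'a::comm_monoid_add"
proof -
  have "(\<Sum>a<m. f (u * m + a)) = sum f (blk m u)" for u
    using sum_blk_refine[of f 1 u m] by (simp add: blk_def)
  then show ?thesis by (simp add: sum_blk_all)
qed

text \<open>
  The increments of a martingale are orthogonal. In terms of the block sums, the squared
  deviations of the \<open>m\<close> children from their average add up to the sum of squares at height \<open>h\<close>
  minus \<open>1 / m\<close> times the sum of squares at height \<open>h + 1\<close>. The weight turns this into a
  telescoping difference; it is the side length of the second factor of the tiles used below.
\<close>

lemma telescoping_energy:
  fixes g :: "nat \<Rightarrow> real"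
  assumes "m > 0"
  defines "S \<equiv> \<lambda>h p. sum g (blk (m ^ h) p)"
  shows "m * (\<Sum>h<M. real (m ^ (M - 1 - h)) * (\<Sum>u<m ^ (M - 1 - h). \<Sum>a<m. (S h (u * m + a) - S (Suc h) u / m)\<^sup>2))
    \<le> real (m ^ M) * (\<Sum>x<m ^ M. (g x)\<^sup>2)"
proof -
  define F where "F h = m ^ (M - h) * (\<Sum>p<m ^ (M - h). (S h p)\<^sup>2)" for h
  have level: "m * (m ^ (M - 1 - h) * (\<Sum>u<m ^ (M - 1 - h). \<Sum>a<m. (S h (u * m + a) - S (Suc h) u / m)\<^sup>2))
      = F h - F (Suc h)" if "h < M" for h
  proof -
    define r where "r = M - 1 - h"
    have r: "M - h = Suc r" "M - Suc h = r" using that by (auto simp: r_def)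
    have "(\<Sum>a<m. (S h (u * m + a) - S (Suc h) u / m)\<^sup>2)
        = (\<Sum>a<m. (S h (u * m + a))\<^sup>2) - (S (Suc h) u)\<^sup>2 / m" for u
    proof -
      have "(\<Sum>a<m. S h (u * m + a)) = S (Suc h) u"
        by (simp add: S_def sum_blk_refine)
      then show ?thesis
        using sum_squared_deviation[of "{..<m}" "\<lambda>a. S h (u * m + a)"] assms(1) by auto
    qed
    then have "(\<Sum>u<m ^ r. \<Sum>a<m. (S h (u * m + a) - S (Suc h) u / m)\<^sup>2)
        = (\<Sum>p<m ^ r * m. (S h p)\<^sup>2) - (\<Sum>u<m ^ r. (S (Suc h) u)\<^sup>2) / m"
      using sum_lessThan_prod[of "\<lambda>p. (S h p)\<^sup>2"] by (simp add: sum_subtractf sum_divide_distrib)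
    then show ?thesis using assms(1)
      by (simp add: F_def r mult.commute[of _ m] right_diff_distrib flip: r_def)
  qed
  have "m * (\<Sum>h<M. m ^ (M - 1 - h) * (\<Sum>u<m ^ (M - 1 - h). \<Sum>a<m. (S h (u * m + a) - S (Suc h) u / m)\<^sup>2))
      = (\<Sum>h<M. F h - F (Suc h))"
    unfolding sum_distrib_left[of "real m"] by (intro sum.cong refl level) simp
  also have "\<dots> = F 0 - F M" by (rule sum_lessThan_telescope')
  also have "\<dots> \<le> F 0" by (simp add: F_def sum_nonneg)
  also have "F 0 = m ^ M * (\<Sum>x<m ^ M. (g x)\<^sup>2)" by (simp add: F_def S_def blk_def)
  finally show ?thesis .
qed

definition cell :: "nat \<Rightarrow> nat \<Rightarrow> nat \<Rightarrow> nat \<Rightarrow> (nat \<times> nat) set" where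
  "cell L K p v = blk L p \<times> blk K v"

text \<open>
  For a fixed colour and a fixed second coordinate \<open>B\<close> the deviations are those of
  \<open>telescoping_energy\<close>, applied to the indicator function of the colour. A tile collects
  \<open>m ^ (M - 1 - h)\<close> values of \<open>B\<close>, and the square of a sum of so many terms is at most that number
  times the sum of the squares, which supplies the weight. Finally each vertex has one colour, so
  the indicator functions of all colours have total at most \<open>(m ^ M)\<^sup>2\<close>.
\<close>

lemma cell_energy:
  fixes c :: "nat \<times> nat \<Rightarrow> nat" and M :: nat
  assumes "m > 0"
  defines "n \<equiv> \<lambda>h u v a s. real (card {x \<in> cell (m ^ h) (m ^ (M - 1 - h)) (u * m + a) v. c x = s})"
  shows "m * (\<Sum>h<M. \<Sum>u<m ^ (M - 1 - h). \<Sum>v<m ^ Suc h. \<Sum>a<m. \<Sum>s<k.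
      (n h u v a s - (\<Sum>j<m. n h u v j s) / m)\<^sup>2) \<le> real (m ^ M) ^ 3"
proof -
  define g where "g s B A = (of_bool (c (A, B) = s) :: real)" for s B A
  define e where "e s h u a B
    = sum (g s B) (blk (m ^ h) (u * m + a)) - sum (g s B) (blk (m ^ Suc h) u) / m" for s h u a B
  have n_eq: "n h u v a s = (\<Sum>B\<in>blk (m ^ (M - 1 - h)) v. sum (g s B) (blk (m ^ h) (u * m + a)))" for h u v a s
  proof -
    let ?X = "cell (m ^ h) (m ^ (M - 1 - h)) (u * m + a) v"
    have "n h u v a s = (\<Sum>x\<in>?X. of_bool (c x = s))"
      by (simp add: n_def of_bool_def sum.If_cases cell_def Int_def)
    also have "\<dots> = (\<Sum>A\<in>blk (m ^ h) (u * m + a). \<Sum>B\<in>blk (m ^ (M - 1 - h)) v. g s B A)"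
      by (simp only: cell_def sum.cartesian_product g_def case_prod_unfold prod.collapse)
    finally show ?thesis by (subst (asm) sum.swap)
  qed
  have dev: "n h u v a s - (\<Sum>j<m. n h u v j s) / m = (\<Sum>B\<in>blk (m ^ (M - 1 - h)) v. e s h u a B)" for h u v a s
  proof -
    have "(\<Sum>j<m. n h u v j s)
        = (\<Sum>B\<in>blk (m ^ (M - 1 - h)) v. \<Sum>j<m. sum (g s B) (blk (m ^ h) (u * m + j)))"
      unfolding n_eq by (rule sum.swap)
    then show ?thesis
      by (simp add: n_eq e_def sum_blk_refine sum_subtractf sum_divide_distrib)
  qed
  have tile: "(\<Sum>v<m ^ Suc h. \<Sum>a<m. (n h u v a s - (\<Sum>j<m. n h u v j s) / m)\<^sup>2)
      \<le> m ^ (M - 1 - h) * (\<Sum>B<m ^ M. \<Sum>a<m. (e s h u a B)\<^sup>2)" if "h < M" for h u s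
  proof -
    let ?K = "m ^ (M - 1 - h)"
    have "(\<Sum>v<m ^ Suc h. \<Sum>a<m. (n h u v a s - (\<Sum>j<m. n h u v j s) / m)\<^sup>2)
        \<le> (\<Sum>v<m ^ Suc h. \<Sum>a<m. ?K * (\<Sum>B\<in>blk ?K v. (e s h u a B)\<^sup>2))"
      unfolding dev using square_sum_le[OF finite_blk] by (intro sum_mono) (metis card_blk)
    also have "\<dots> = ?K * (\<Sum>v<m ^ Suc h. \<Sum>B\<in>blk ?K v. \<Sum>a<m. (e s h u a B)\<^sup>2)"
      unfolding sum_distrib_left by (intro sum.cong refl sum.swap)
    also have "\<dots> = ?K * (\<Sum>B<m ^ Suc h * ?K. \<Sum>a<m. (e s h u a B)\<^sup>2)"
      by (simp only: sum_blk_all)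
    also have "m ^ Suc h * ?K = m ^ M" using that by (simp flip: power_add power_Suc)
    finally show ?thesis .
  qed
  have colour: "m * (\<Sum>h<M. \<Sum>u<m ^ (M - 1 - h). \<Sum>v<m ^ Suc h. \<Sum>a<m.
      (n h u v a s - (\<Sum>j<m. n h u v j s) / m)\<^sup>2) \<le> m ^ M * (\<Sum>B<m ^ M. \<Sum>A<m ^ M. g s B A)" for s
  proof -
    have "(\<Sum>h<M. \<Sum>u<m ^ (M - 1 - h). \<Sum>v<m ^ Suc h. \<Sum>a<m.
        (n h u v a s - (\<Sum>j<m. n h u v j s) / m)\<^sup>2)
        \<le> (\<Sum>h<M. \<Sum>u<m ^ (M - 1 - h). m ^ (M - 1 - h) * (\<Sum>B<m ^ M. \<Sum>a<m. (e s h u a B)\<^sup>2))"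
      using tile by (intro sum_mono) simp
    also have "\<dots> = (\<Sum>h<M. \<Sum>B<m ^ M. m ^ (M - 1 - h) * (\<Sum>u<m ^ (M - 1 - h). \<Sum>a<m. (e s h u a B)\<^sup>2))"
      unfolding sum_distrib_left by (intro sum.cong refl sum.swap)
    also have "\<dots> = (\<Sum>B<m ^ M. \<Sum>h<M. m ^ (M - 1 - h) * (\<Sum>u<m ^ (M - 1 - h). \<Sum>a<m. (e s h u a B)\<^sup>2))"
      by (rule sum.swap)
    finally have "m * (\<Sum>h<M. \<Sum>u<m ^ (M - 1 - h). \<Sum>v<m ^ Suc h. \<Sum>a<m.
        (n h u v a s - (\<Sum>j<m. n h u v j s) / m)\<^sup>2)
        \<le> m * (\<Sum>B<m ^ M. \<Sum>h<M. m ^ (M - 1 - h) * (\<Sum>u<m ^ (M - 1 - h). \<Sum>a<m. (e s h u a B)\<^sup>2))"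
      by (rule mult_left_mono) simp
    also have "\<dots> = (\<Sum>B<m ^ M. m * (\<Sum>h<M. m ^ (M - 1 - h) * (\<Sum>u<m ^ (M - 1 - h). \<Sum>a<m. (e s h u a B)\<^sup>2)))"
      by (rule sum_distrib_left)
    also have "\<dots> \<le> (\<Sum>B<m ^ M. m ^ M * (\<Sum>A<m ^ M. (g s B A)\<^sup>2))"
      unfolding e_def by (intro sum_mono telescoping_energy assms)
    also have "\<dots> = m ^ M * (\<Sum>B<m ^ M. \<Sum>A<m ^ M. g s B A)"
      by (simp add: sum_distrib_left g_def power2_eq_square)
    finally show ?thesis .
  qed
  have swap: "(\<Sum>h<M. \<Sum>u<m ^ (M - 1 - h). \<Sum>v<m ^ Suc h. \<Sum>a<m. \<Sum>s<k. f h u v a s)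
      = (\<Sum>s<k. \<Sum>h<M. \<Sum>u<m ^ (M - 1 - h). \<Sum>v<m ^ Suc h. \<Sum>a<m. f h u v a s)"
    for f :: "nat \<Rightarrow> nat \<Rightarrow> nat \<Rightarrow> nat \<Rightarrow> nat \<Rightarrow> real"
    by (induction k) (simp_all add: sum.distrib)
  have "m * (\<Sum>h<M. \<Sum>u<m ^ (M - 1 - h). \<Sum>v<m ^ Suc h. \<Sum>a<m. \<Sum>s<k.
      (n h u v a s - (\<Sum>j<m. n h u v j s) / m)\<^sup>2)
      = (\<Sum>s<k. m * (\<Sum>h<M. \<Sum>u<m ^ (M - 1 - h). \<Sum>v<m ^ Suc h. \<Sum>a<m.
      (n h u v a s - (\<Sum>j<m. n h u v j s) / m)\<^sup>2))"
    unfolding swap by (rule sum_distrib_left)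
  also have "\<dots> \<le> (\<Sum>s<k. m ^ M * (\<Sum>B<m ^ M. \<Sum>A<m ^ M. g s B A))"
    by (intro sum_mono colour)
  also have "\<dots> = m ^ M * (\<Sum>B<m ^ M. \<Sum>A<m ^ M. \<Sum>s<k. g s B A)"
    unfolding sum_distrib_left[symmetric]
    by (subst sum.swap, intro arg_cong[where f = "(*) _"] sum.cong refl sum.swap)
  also have "\<dots> \<le> real (m ^ M) * (\<Sum>B<m ^ M. \<Sum>A<m ^ M. 1)"
  proof (intro mult_left_mono sum_mono)
    fix B A
    have "(\<Sum>s<k. g s B A) = (\<Sum>s<k. if s = c (A, B) then 1 else 0)"
      by (intro sum.cong refl) (auto simp: g_def)
    also have "\<dots> \<le> 1" by simp
    finally show "(\<Sum>s<k. g s B A) \<le> 1" .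
  qed simp
  also have "\<dots> = real (m ^ M) ^ 3" by (simp add: power3_eq_cube)
  finally show ?thesis by simp
qed

section \<open>The tile graph\<close>

text \<open>
  A tile is given by its level \<open>h\<close> and the indices \<open>u\<close> and \<open>v\<close> of its two intervals, of lengths
  \<open>m ^ (h + 1)\<close> and \<open>m ^ (M - 1 - h)\<close>. The product of these lengths is the same at all levels.
\<close>

definition tiles :: "nat \<Rightarrow> nat \<Rightarrow> (nat \<times> nat \<times> nat) set" where
  "tiles m M = (SIGMA h:{..<M}. {..<m ^ (M - 1 - h)} \<times> {..<m ^ Suc h})"

definition child :: "nat \<Rightarrow> nat \<Rightarrow> nat \<times> nat \<times> nat \<Rightarrow> nat \<Rightarrow> (nat \<times> nat) set" where
  "child m M = (\<lambda>(h, u, v) a. cell (m ^ h) (m ^ (M - 1 - h)) (u * m + a) v)"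

definition tile_pairs :: "nat \<Rightarrow> nat \<Rightarrow> nat \<times> nat \<times> nat \<Rightarrow> ((nat \<times> nat) \<times> nat \<times> nat) set" where
  "tile_pairs m M t = (\<Union>j<m. \<Union>i<j. child m M t i \<times> child m M t j)"

definition lex_index :: "nat \<Rightarrow> nat \<times> nat \<Rightarrow> nat" where
  "lex_index W = (\<lambda>(A, B). A * W + B)"

definition tile_graph :: "nat \<Rightarrow> nat \<Rightarrow> nat ograph" where
  "tile_graph m M = \<lparr>verts = lex_index (m ^ M) ` ({..<m ^ M} \<times> {..<m ^ M}),
     edges = (\<lambda>(x, y). {lex_index (m ^ M) x, lex_index (m ^ M) y}) ` (\<Union>t\<in>tiles m M. tile_pairs m M t)\<rparr>"

lemma sum_tiles:
  "(\<Sum>(h, u, v)\<in>tiles m M. f h u v) = (\<Sum>h<M. \<Sum>u<m ^ (M - 1 - h). \<Sum>v<m ^ Suc h. f h u v)"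
  for f :: "nat \<Rightarrow> nat \<Rightarrow> nat \<Rightarrow> 'a::comm_monoid_add"
  unfolding tiles_def by (subst sum.Sigma[symmetric]) (auto simp: sum.cartesian_product)

lemma finite_tiles [simp]: "finite (tiles m M)"
  by (simp add: tiles_def)

lemma card_tiles: "card (tiles m M) = M * m ^ M"
proof -
  have "card (tiles m M) = (\<Sum>h<M. m ^ (M - 1 - h) * m ^ Suc h)"
    by (simp add: tiles_def)
  also have "\<dots> = (\<Sum>h<M. m ^ M)"
    by (intro sum.cong refl) (simp flip: power_add power_Suc)
  finally show ?thesis by simp
qed

lemma finite_child [simp]: "finite (child m M t a)"
  by (cases t) (simp add: child_def cell_def)

lemma card_child: "t \<in> tiles m M \<Longrightarrow> card (child m M t a) = m ^ (M - 1)"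
  by (cases t) (auto simp: child_def cell_def tiles_def card_cartesian_product simp flip: power_add)

context
  fixes m M :: nat
  assumes m: "m > 0"
begin

lemma mem_child:
  "(A, B) \<in> child m M (h, u, v) a \<longleftrightarrow> A div m ^ h = u * m + a \<and> B div m ^ (M - 1 - h) = v"
  using m by (simp add: child_def cell_def mem_blk)

lemma child_disjoint: "a \<noteq> a' \<Longrightarrow> child m M t a \<inter> child m M t a' = {}"
  by (cases t) (auto simp: mem_child)

lemma child_subset:
  assumes "t \<in> tiles m M" "a < m"
  shows "child m M t a \<subseteq> {..<m ^ M} \<times> {..<m ^ M}"
proof
  fix x assume x: "x \<in> child m M t a"
  obtain A B h u v where [simp]: "x = (A, B)" "t = (h, u, v)" by (cases x; cases t)
  define r where "r = M - 1 - h"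
  have h: "M = Suc h + r" "u < m ^ r" "v < m ^ Suc h"
    using assms(1) by (auto simp: tiles_def r_def)
  have AB: "A div m ^ h = u * m + a" "B div m ^ r = v" using x by (auto simp: mem_child r_def)
  have "u * m + a < Suc u * m" using assms(2) by simp
  also have "\<dots> \<le> m ^ r * m" using h(2) by (intro mult_right_mono) auto
  finally have "A div m ^ h < m ^ r * m" using AB(1) by simp
  then have "A < m ^ r * m * m ^ h" using m by (simp add: div_less_iff_less_mult)
  moreover have "B div m ^ r < m ^ Suc h" using AB(2) h(3) by simp
  then have "B < m ^ Suc h * m ^ r" using m by (simp add: div_less_iff_less_mult del: power_Suc)
  ultimately show "x \<in> {..<m ^ M} \<times> {..<m ^ M}"
    unfolding h(1) by (simp add: power_add mult_ac)
qed

lemma card_tile: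
  assumes "t \<in> tiles m M"
  shows "card (\<Union>a<m. child m M t a) = m ^ M"
proof -
  have "card (\<Union>a<m. child m M t a) = (\<Sum>a<m. card (child m M t a))"
    using child_disjoint by (intro card_UN_disjoint) auto
  also have "\<dots> = m ^ Suc (M - 1)" using assms by (simp add: card_child)
  also have "Suc (M - 1) = M" using assms by (auto simp: tiles_def)
  finally show ?thesis .
qed

lemma finite_tile_pairs [simp]: "finite (tile_pairs m M t)"
  by (auto simp: tile_pairs_def)

lemma card_tile_pairs:
  assumes "t \<in> tiles m M"
  shows "real (card (tile_pairs m M t)) = (real m - 1) / (2 * m) * real (m ^ M) ^ 2"
proof -
  have index: "a = a'" if "x \<in> child m M t a" "x \<in> child m M t a'" for x a a'
    using child_disjoint[of a a' t] that by blast
  have "card (tile_pairs m M t) = (\<Sum>j<m. card (\<Union>i<j. child m M t i \<times> child m M t j))"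
    unfolding tile_pairs_def by (intro card_UN_disjoint ballI impI) (auto dest: index)
  also have "\<dots> = (\<Sum>j<m. \<Sum>i<j. card (child m M t i \<times> child m M t j))"
    by (intro sum.cong refl card_UN_disjoint ballI impI) (auto dest: index)
  also have "real \<dots> = (\<Sum>j<m. \<Sum>i<j. real (m ^ (M - 1)) ^ 2)"
    using assms by (simp add: card_child card_cartesian_product power2_eq_square)
  also have "\<dots> = real (m ^ (M - 1)) ^ 2 * (real m * (real m - 1) / 2)"
    by (rule sum_triangle)
  also have "\<dots> = (real m - 1) / (2 * m) * real (m ^ Suc (M - 1)) ^ 2"
    using m by (simp add: field_simps power2_eq_square)
  also have "Suc (M - 1) = M" using assms by (auto simp: tiles_def)
  finally show ?thesis .
qed

text \<open>
  The level \<open>h\<close> is determined by the first coordinates of a pair: they agree after division by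
  \<open>m ^ (h + 1)\<close> and differ after division by \<open>m ^ h\<close>. The indices of the tile are then quotients of
  the coordinates.
\<close>

lemma tile_pairs_disjoint:
  assumes "t \<in> tiles m M" "t' \<in> tiles m M" "t \<noteq> t'"
  shows "tile_pairs m M t \<inter> tile_pairs m M t' = {}"
proof -
  have pairD: "A div m ^ Suc h = u \<and> A' div m ^ Suc h = u \<and> A div m ^ h < A' div m ^ h \<and> B div m ^ (M - 1 - h) = v"
    if p: "((A, B), (A', B')) \<in> tile_pairs m M (h, u, v)" for A B A' B' h u v
  proof -
    obtain i j where "i < j" "j < m" "A div m ^ h = u * m + i" "A' div m ^ h = u * m + j"
        "B div m ^ (M - 1 - h) = v"
      using p by (auto simp: tile_pairs_def mem_child)
    then show ?thesis
      by (simp add: power_Suc2 div_mult2_eq del: power_Suc)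
  qed
  have level: "\<not> h < h'"
    if "((A, B), (A', B')) \<in> tile_pairs m M (h, u, v)" "((A, B), (A', B')) \<in> tile_pairs m M (h', u', v')"
    for A B A' B' h u v h' u' v'
  proof
    assume "h < h'"
    then obtain d where h': "h' = Suc h + d" by (metis less_iff_Suc_add add_Suc)
    have "A div m ^ h' = A' div m ^ h'"
      unfolding h' power_add div_mult2_eq using pairD[OF that(1)] by simp
    then show False using pairD[OF that(2)] by simp
  qed
  show ?thesis
  proof (rule ccontr)
    assume "tile_pairs m M t \<inter> tile_pairs m M t' \<noteq> {}"
    then obtain A B A' B' where p: "((A, B), (A', B')) \<in> tile_pairs m M t"
        "((A, B), (A', B')) \<in> tile_pairs m M t'" by auto
    obtain h u v h' u' v' where [simp]: "t = (h, u, v)" "t' = (h', u', v')" by (cases t; cases t')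
    have "h = h'" using level p by (metis \<open>t = _\<close> \<open>t' = _\<close> linorder_neqE_nat)
    then have "t = t'" using p pairD[of A B A' B' h u v] pairD[of A B A' B' h' u' v'] by simp
    with assms(3) show False ..
  qed
qed

text \<open>
  The vertices of a later child have larger first coordinates, so the order of the children is
  the order of the vertices, however the second coordinates compare.
\<close>

lemma lex_index_less:
  assumes "t \<in> tiles m M" "(x, y) \<in> tile_pairs m M t"
  shows "lex_index (m ^ M) x < lex_index (m ^ M) y"
proof -
  obtain i j where ij: "i < j" "j < m" "x \<in> child m M t i" "y \<in> child m M t j"
    using assms(2) by (auto simp: tile_pairs_def)
  obtain A B A' B' h u v where [simp]: "x = (A, B)" "y = (A', B')" "t = (h, u, v)"
    by (cases x; cases y; cases t)
  have "A div m ^ h < A' div m ^ h" using ij by (simp add: mem_child)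
  then have "A < A'" by (meson div_le_mono leD leI)
  moreover have "B < m ^ M" using child_subset[OF assms(1), of i] ij by auto
  ultimately have "A * m ^ M + B < Suc A * m ^ M" by simp
  also have "\<dots> \<le> A' * m ^ M" using \<open>A < A'\<close> by (intro mult_right_mono) auto
  finally show ?thesis by (simp add: lex_index_def)
qed

lemma inj_on_lex_index: "inj_on (lex_index W) (UNIV \<times> {..<W})"
proof (rule inj_onI)
  fix x y assume "x \<in> UNIV \<times> {..<W}" "y \<in> UNIV \<times> {..<W}" and eq: "lex_index W x = lex_index W y"
  then obtain A B A' B' where xy: "x = (A, B)" "y = (A', B')" "B < W" "B' < W" by auto
  have "A = (A * W + B) div W" "A' = (A' * W + B') div W" using xy by auto
  moreover have index_eq: "A * W + B = A' * W + B'" using eq xy by (simp add: lex_index_def)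
  ultimately have "A = A'" by metis
  with index_eq xy show "x = y" by simp
qed

lemma tile_pairs_subset:
  assumes "t \<in> tiles m M"
  shows "tile_pairs m M t \<subseteq> ({..<m ^ M} \<times> {..<m ^ M}) \<times> ({..<m ^ M} \<times> {..<m ^ M})"
  unfolding tile_pairs_def by (intro UN_least Sigma_mono child_subset assms) auto

lemma inj_on_edge:
  "inj_on (\<lambda>(x, y). {lex_index (m ^ M) x, lex_index (m ^ M) y}) (\<Union>t\<in>tiles m M. tile_pairs m M t)"
proof (rule inj_onI, clarify)
  let ?c = "lex_index (m ^ M)"
  fix x y x' y' t t'
  assume t: "t \<in> tiles m M" "(x, y) \<in> tile_pairs m M t" "t' \<in> tiles m M" "(x', y') \<in> tile_pairs m M t'"
    and eq: "{?c x, ?c y} = {?c x', ?c y'}"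
  have "?c x < ?c y" "?c x' < ?c y'" using t lex_index_less by auto
  with eq have "?c x = ?c x'" "?c y = ?c y'" by (auto simp: doubleton_eq_iff)
  moreover have "{x, y, x', y'} \<subseteq> UNIV \<times> {..<m ^ M}"
    using tile_pairs_subset[OF t(1)] tile_pairs_subset[OF t(3)] t by auto
  ultimately show "x = x' \<and> y = y'" using inj_on_lex_index[of "m ^ M"] by (auto dest: inj_onD)
qed

lemma ordered_graph_tile_graph: "ordered_graph (tile_graph m M)"
proof -
  have "e \<subseteq> verts (tile_graph m M) \<and> card e = 2" if edge: "e \<in> edges (tile_graph m M)" for e
  proof -
    obtain x y t where e: "t \<in> tiles m M" "(x, y) \<in> tile_pairs m M t" "e = {lex_index (m ^ M) x, lex_index (m ^ M) y}"
      using edge by (auto simp: tile_graph_def)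
    then show ?thesis
      using lex_index_less[OF e(1,2)] tile_pairs_subset[OF e(1)] by (auto simp: tile_graph_def card_2_iff)
  qed
  then show ?thesis by (simp add: ordered_graph_def tile_graph_def)
qed

lemma card_edges_tile_graph:
  "real (card (edges (tile_graph m M))) = (real m - 1) / (2 * m) * M * real (m ^ M) ^ 3"
proof -
  have "card (edges (tile_graph m M)) = card (\<Union>t\<in>tiles m M. tile_pairs m M t)"
    unfolding tile_graph_def using inj_on_edge by (simp add: card_image)
  also have "\<dots> = (\<Sum>t\<in>tiles m M. card (tile_pairs m M t))"
    using tile_pairs_disjoint by (intro card_UN_disjoint) auto
  also have "real \<dots> = (\<Sum>t\<in>tiles m M. (real m - 1) / (2 * m) * real (m ^ M) ^ 2)"
    by (simp add: card_tile_pairs)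
  also have "\<dots> = (real m - 1) / (2 * m) * M * real (m ^ M) ^ 3"
    by (simp add: card_tiles power2_eq_square power3_eq_cube)
  finally show ?thesis .
qed

end

section \<open>The upper bound\<close>

lemma two_mult_abs_le:
  fixes w x \<theta> :: real
  assumes "\<theta> > 0"
  shows "2 * w * \<bar>x\<bar> \<le> \<theta> * w\<^sup>2 + x\<^sup>2 / \<theta>"
proof -
  have "0 \<le> (\<theta> * w - \<bar>x\<bar>)\<^sup>2" by simp
  also have "\<dots> = \<theta> * (\<theta> * w\<^sup>2 + x\<^sup>2 / \<theta>) - \<theta> * (2 * w * \<bar>x\<bar>)"
    using assms by (simp add: power2_diff power_mult_distrib distrib_left power2_eq_square[of \<theta>])
  finally have "\<theta> * (2 * w * \<bar>x\<bar>) \<le> \<theta> * (\<theta> * w\<^sup>2 + x\<^sup>2 / \<theta>)" by (simp only: diff_ge_0_iff_ge)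
  then show ?thesis using assms by (rule mult_left_le_imp_le)
qed

text \<open>
  The edge bounds of all tiles are added up. They contain the absolute values of the deviations,
  whereas the energy controls the squares; the parameter \<open>\<theta>\<close> weighs the two terms of the inequality
  between the arithmetic and the geometric mean that connects them.
\<close>

lemma Q2_free_edges_bound:
  fixes \<theta> :: real
  assumes m: "m > 0" and H: "subgraph H (tile_graph m M)" and free: "\<not> contains_ordered_copy H (Q2 b)"
    and \<theta>: "\<theta> > 0"
  shows "real (card (edges H)) \<le>
    (M * (1 / 4 + m * Suc b * \<theta>) + 1 / (m * \<theta>)) * real (m ^ M) ^ 3"
proof -
  let ?W = "m ^ M" and ?c = "lex_index (m ^ M)"
  define w where "w = real ?W"
  have ord: "ordered_graph H" using H by (simp add: subgraph_def)
  obtain c0 where c0: "\<And>x. c0 x \<le> b"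
    "\<And>x y. x < y \<Longrightarrow> {x, y} \<in> edges H \<Longrightarrow> c0 x < c0 y \<or> c0 x = 0 \<and> c0 y = 0"
    "\<And>x y z. \<lbrakk>{x, y} \<in> edges H; {y, z} \<in> edges H; {x, z} \<in> edges H\<rbrakk>
      \<Longrightarrow> c0 x \<noteq> 0 \<or> c0 y \<noteq> 0 \<or> c0 z \<noteq> 0"
    by (rule Q2_free_colouring[OF ord free]) (rule that)
  define c where "c x = c0 (?c x)" for x
  define P where "P t = {(x, y) \<in> tile_pairs m M t. {?c x, ?c y} \<in> edges H}" for t
  define n where "n t a s = real (card {x \<in> child m M t a. c x = s})" for t a s
  define d where "d t a s = n t a s - (\<Sum>j<m. n t j s) / m" for t a s
  have finP: "finite (P t)" for t
    by (rule finite_subset[OF _ finite_tile_pairs[OF m]]) (auto simp: P_def)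
  have "edges H \<subseteq> (\<lambda>(x, y). {?c x, ?c y}) ` (\<Union>t\<in>tiles m M. P t)"
  proof
    fix e assume e: "e \<in> edges H"
    then have "e \<in> edges (tile_graph m M)" using H by (auto simp: subgraph_def)
    then obtain t x y where "t \<in> tiles m M" "(x, y) \<in> tile_pairs m M t" "e = {?c x, ?c y}"
      by (auto simp: tile_graph_def)
    with e show "e \<in> (\<lambda>(x, y). {?c x, ?c y}) ` (\<Union>t\<in>tiles m M. P t)"
      by (intro image_eqI[of _ _ "(x, y)"]) (auto simp: P_def)
  qed
  then have "card (edges H) \<le> card (\<Union>t\<in>tiles m M. P t)"
    using finP by (intro surj_card_le) auto
  also have "\<dots> \<le> (\<Sum>t\<in>tiles m M. card (P t))" by (rule card_UN_le) simp
  finally have "real (card (edges H)) \<le> real (\<Sum>t\<in>tiles m M. card (P t))"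
    by (rule of_nat_mono)
  also have "\<dots> = (\<Sum>t\<in>tiles m M. real (card (P t)))" by simp
  also have "\<dots> \<le> (\<Sum>t\<in>tiles m M. w\<^sup>2 / 4 + m * Suc b * \<theta> * w\<^sup>2 + (\<Sum>a<m. \<Sum>s<Suc b. (d t a s)\<^sup>2) / \<theta>)"
  proof (rule sum_mono)
    fix t assume t: "t \<in> tiles m M"
    have "real (card (P t)) \<le> (real (card (\<Union>a<m. child m M t a)))\<^sup>2 / 4
        + 2 * real (card (\<Union>a<m. child m M t a)) * (\<Sum>a<m. \<Sum>s<Suc b. \<bar>d t a s\<bar>)"
      unfolding d_def n_def
    proof (rule tile_edge_bound)
      show "P t \<subseteq> (\<Union>j<m. \<Union>i<j. child m M t i \<times> child m M t j)"
        by (auto simp: P_def tile_pairs_def)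
      show "c x < c y \<or> c x = 0 \<and> c y = 0" if "(x, y) \<in> P t" for x y
        using that lex_index_less[OF m t] c0(2) by (simp add: P_def c_def)
      show "c x \<noteq> 0 \<or> c y \<noteq> 0 \<or> c z \<noteq> 0"
        if "(x, y) \<in> P t \<union> (P t)\<inverse>" "(y, z) \<in> P t \<union> (P t)\<inverse>" "(x, z) \<in> P t \<union> (P t)\<inverse>" for x y z
      proof -
        have "{?c x, ?c y} \<in> edges H" if "(x, y) \<in> P t \<union> (P t)\<inverse>" for x y
          using that by (auto simp: P_def insert_commute)
        with that show ?thesis unfolding c_def by (intro c0(3))
      qed
    qed (use m c0(1) child_disjoint[OF m] in \<open>auto simp: c_def less_Suc_eq_le\<close>)
    also have "\<dots> = w\<^sup>2 / 4 + (\<Sum>a<m. \<Sum>s<Suc b. 2 * w * \<bar>d t a s\<bar>)"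
      unfolding card_tile[OF m t] w_def by (simp only: sum_distrib_left)
    also have "\<dots> \<le> w\<^sup>2 / 4 + (\<Sum>a<m. \<Sum>s<Suc b. \<theta> * w\<^sup>2 + (d t a s)\<^sup>2 / \<theta>)"
      by (intro add_left_mono sum_mono two_mult_abs_le \<theta>)
    also have "(\<Sum>a<m. \<Sum>s<Suc b. \<theta> * w\<^sup>2 + (d t a s)\<^sup>2 / \<theta>)
        = m * Suc b * \<theta> * w\<^sup>2 + (\<Sum>a<m. \<Sum>s<Suc b. (d t a s)\<^sup>2) / \<theta>"
      by (simp only: sum.distrib sum_divide_distrib sum_constant card_lessThan) (simp add: algebra_simps)
    finally show "real (card (P t))
        \<le> w\<^sup>2 / 4 + m * Suc b * \<theta> * w\<^sup>2 + (\<Sum>a<m. \<Sum>s<Suc b. (d t a s)\<^sup>2) / \<theta>"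
      by simp
  qed
  also have "\<dots> = M * (1 / 4 + m * Suc b * \<theta>) * w ^ 3
      + (\<Sum>t\<in>tiles m M. \<Sum>a<m. \<Sum>s<Suc b. (d t a s)\<^sup>2) / \<theta>"
    by (simp only: sum.distrib sum_divide_distrib sum_constant card_tiles)
      (simp add: algebra_simps power2_eq_square power3_eq_cube w_def)
  also have "(\<Sum>t\<in>tiles m M. \<Sum>a<m. \<Sum>s<Suc b. (d t a s)\<^sup>2) \<le> w ^ 3 / m"
  proof -
    have "(\<Sum>t\<in>tiles m M. \<Sum>a<m. \<Sum>s<Suc b. (d t a s)\<^sup>2)
        = (\<Sum>(h, u, v)\<in>tiles m M. \<Sum>a<m. \<Sum>s<Suc b. (d (h, u, v) a s)\<^sup>2)"
      by (simp only: case_prod_unfold prod.collapse)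
    then have "m * (\<Sum>t\<in>tiles m M. \<Sum>a<m. \<Sum>s<Suc b. (d t a s)\<^sup>2) \<le> w ^ 3"
      unfolding sum_tiles d_def n_def child_def w_def prod.case
      using cell_energy[OF m, where k = "Suc b" and c = c and M = M] by simp
    then show ?thesis using m by (simp add: field_simps)
  qed
  finally show ?thesis using \<theta> by (simp add: w_def field_simps)
qed

text \<open>
  Of the two error terms of the edge bound, one grows and one decreases with \<open>\<theta>\<close>. The choice of \<open>\<theta>\<close>
  makes the first of them \<open>M / m\<close> times \<open>real (m ^ M) ^ 3\<close>, and \<open>M\<close> is the number of levels for
  which the second one is the same. The rest of the loss comes from the missing pairs inside the
  children: a tile has slightly fewer edges than half of its squared size.
\<close>

lemma rel_turan_density_Q2_le:
  assumes "m \<ge> 2"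
  shows "rel_turan_density (Q2 b) \<le> 1 / 2 + 9 / 2 / (real m - 1)"
proof -
  define M where "M = m\<^sup>2 * Suc b"
  define \<theta> where "\<theta> = 1 / (real m ^ 2 * Suc b)"
  let ?G = "tile_graph m M" and ?w = "real (m ^ M) ^ 3"
  have m: "m > 0" and \<theta>: "\<theta> > 0" using assms by (auto simp: \<theta>_def)
  have "M > 0" "?w > 0" using m by (auto simp: M_def)
  then have G_card: "real (card (edges ?G)) > 0"
    using assms unfolding card_edges_tile_graph[OF m] by (intro mult_pos_pos divide_pos_pos) auto
  obtain H where H: "subgraph H ?G" "\<not> contains_ordered_copy H (Q2 b)" "ex_ord ?G (Q2 b) = card (edges H)"
    using ex_ord_attained[OF ordered_graph_tile_graph[OF m], of "Q2 b" M] by (auto simp: Q2_def)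
  have "real (ex_ord ?G (Q2 b)) \<le> (M * (1 / 4 + m * Suc b * \<theta>) + 1 / (m * \<theta>)) * ?w"
    unfolding H(3) by (rule Q2_free_edges_bound[OF m H(1,2) \<theta>])
  also have "M * (1 / 4 + m * Suc b * \<theta>) + 1 / (m * \<theta>) = M * (1 / 4 + 2 / m)"
  proof -
    have "m * Suc b * \<theta> = 1 / m" "1 / (m * \<theta>) = M / m"
      using m by (simp_all add: \<theta>_def M_def power2_eq_square del: of_nat_Suc mult_Suc_right)
    then show ?thesis by (simp add: distrib_left)
  qed
  finally have ex_le: "real (ex_ord ?G (Q2 b)) \<le> M * (1 / 4 + 2 / m) * ?w" .
  have "rel_turan_density (Q2 b) \<le> real (ex_ord ?G (Q2 b)) / real (card (edges ?G))"
    unfolding rel_turan_density_def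
  proof (rule cINF_lower)
    show "?G \<in> {G. ordered_graph G \<and> edges G \<noteq> {}}"
      using G_card ordered_graph_tile_graph[OF m] by auto
    show "bdd_below ((\<lambda>G. real (ex_ord G (Q2 b)) / real (card (edges G))) ` {G. ordered_graph G \<and> edges G \<noteq> {}})"
      by (intro bdd_belowI[of _ 0]) auto
  qed
  also have "\<dots> \<le> M * (1 / 4 + 2 / m) * ?w / real (card (edges ?G))"
    using ex_le by (intro divide_right_mono) auto
  also have "\<dots> = (1 / 4 + 2 / m) / ((real m - 1) / (2 * m))"
    unfolding card_edges_tile_graph[OF m] using \<open>M > 0\<close> \<open>?w > 0\<close> by simp
  also have "\<dots> = 1 / 2 + 9 / 2 / (real m - 1)"
    using assms by (simp add: field_simps)
  finally show ?thesis .
qed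

theorem theorem1p1:
  fixes b :: nat
  assumes "b \<ge> 1"
  shows "rel_turan_density (Q2 b) = 1 / 2"
proof (rule antisym)
  have "(\<lambda>n. 1 / 2 + 9 / 2 * inverse (real (Suc n))) \<longlonglongrightarrow> 1 / 2 + 9 / 2 * 0"
    by (intro tendsto_intros LIMSEQ_inverse_real_of_nat)
  then have lim: "(\<lambda>n. 1 / 2 + 9 / 2 * inverse (real (Suc n))) \<longlonglongrightarrow> 1 / 2"
    by (simp only: mult_zero_right add_0_right)
  have le: "rel_turan_density (Q2 b) \<le> 1 / 2 + 9 / 2 * inverse (real (Suc n))" for n
  proof -
    have "2 \<le> Suc (Suc n)" "real (Suc (Suc n)) - 1 = real (Suc n)" by simp_all
    then show ?thesis
      using rel_turan_density_Q2_le[of "Suc (Suc n)" b] by (simp only: divide_inverse)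
  qed
  show "rel_turan_density (Q2 b) \<le> 1 / 2"
    by (rule LIMSEQ_le_const[OF lim]) (use le in blast)
qed (rule rel_turan_density_Q2_ge)

end
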